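(* Let $X$ be a topological manifold, $\Phi$ a flow on $X$, and $A\subset X$ a regular open set whose boundary $\partial A$ is a locally flat manifold of codimension one. Then $A$ is forward invariant and $\partial A$ is forward topologically transversal to $\Phi$ if and only if all points on $\partial A$ are of type C.
   Context: Topological manifolds and submanifolds are without boundary. A flow on $X$ is a continuous map $\Phi:\mathbb{R}\times X\to X$ with $\Phi(0,x)=x$ and $\Phi(s+t,x)=\Phi(s,\Phi(t,x))$. An open set $A$ is regular if $\partial A=\partial\bar A$. A set $A$ is forward invariant if $\{\Phi(t,x)\mid t\ge 0\}\subset A$ for all $x\in A$. A partial map is a map defined on a subset (its domain $\mathrm{dom}$) of its source. First-out map: for an open set $A\subset X$, $E_A:\partial A\to\partial A$ is the partial map $E_A(x)=\Phi(T^e_A(x),x)$, where $T^e_A(x)=\inf\{t>0\mid\Phi(t,x)\notin A\}$; $x\in\mathrm{dom}\,E_A$ iff this set of times is nonempty. First-in map: for a closed set $B\subset X$, $R_B:\partial B\to\partial B$ is the partial map $R_B(x)=\Phi(T^r_B(x),x)$, where $T^r_B(x)=\inf\{t>0\mid\Phi(t,x)\in B\}$; $x\in\mathrm{dom}\,R_B$ iff this set of times is nonempty. A point $x\in\partial A$ is of type C if $x\in\mathrm{dom}\,R_{\bar A}\setminus\mathrm{dom}\,E_A$. Forward topological transversality: let $X$ be $n$-dimensional. A submanifold $S\subset X$ is forward topologically transversal to $\Phi$ at $x\in S$ if (1) $S$ is of codimension one and locally flat; (2) there exist a neighborhood $U$ of $x$ in $X$ and a homeomorphism $\phi:U\to B\subset\mathbb{R}^n$,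 where $B$ is a unit ball, such that $\phi(U\cap S)=B\cap(\mathbb{R}^{n-1}\times\{0\})$, and there exists $\delta_+(x)>0$ such that $\Phi((0,\delta_+(x)],x)$ is contained in a connected component of $U\setminus S$. $S$ is forward topologically transversal to $\Phi$ if this holds at every point of $S$. *)

theory Defs
  imports "HOL-Analysis.Analysis"
begin

definition topological_manifold :: "nat \<Rightarrow> 'a topology \<Rightarrow> bool" where
  "topological_manifold n X \<longleftrightarrow>
     Hausdorff_space X \<and> second_countable X \<and>
     (\<forall>x\<in>topspace X. \<exists>U V. openin X U \<and> x \<in> U \<and> openin (Euclidean_space n) V \<and>
        subtopology X U homeomorphic_space subtopology (Euclidean_space n) V)"

text \<open>
  \<^term>\<open>Euclidean_space n\<close> consists of the sequences \<^term>\<open>x :: nat \<Rightarrow> real\<close> with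
  \<^term>\<open>x i = 0\<close> for all \<^term>\<open>i \<ge> n\<close>.  Hence, for \<^term>\<open>m \<le> n\<close>, the carrier of
  \<^term>\<open>Euclidean_space m\<close> is the standard subspace of \<^term>\<open>Euclidean_space n\<close> on which the
  last \<^term>\<open>n - m\<close> coordinates vanish.
\<close>

definition unit_ball :: "nat \<Rightarrow> (nat \<Rightarrow> real) set" where
  "unit_ball n = {x \<in> topspace (Euclidean_space n). (\<Sum>i<n. (x i)\<^sup>2) < 1}"

text \<open>
  A locally flat submanifold \<^term>\<open>S\<close> of codimension \<^term>\<open>k\<close> in the \<^term>\<open>n\<close>-manifold
  \<^term>\<open>X\<close>: near each of its points, the pair formed by \<^term>\<open>X\<close> and \<^term>\<open>S\<close> is homeomorphic
  to a Euclidean space with its standard subspace of codimension \<^term>\<open>k\<close>.  The condition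
  \<^term>\<open>k \<le> n\<close> is imposed only in the presence of a point, so that the empty set is a submanifold of every
  codimension.
\<close>

definition locally_flat_submanifold :: "nat \<Rightarrow> nat \<Rightarrow> 'a topology \<Rightarrow> 'a set \<Rightarrow> bool" where
  "locally_flat_submanifold n k X S \<longleftrightarrow>
     S \<subseteq> topspace X \<and> topological_manifold (n - k) (subtopology X S) \<and>
     (\<forall>x\<in>S. k \<le> n \<and> (\<exists>U \<phi>. openin X U \<and> x \<in> U \<and>
        homeomorphic_map (subtopology X U) (Euclidean_space n) \<phi> \<and>
        \<phi> ` (U \<inter> S) = topspace (Euclidean_space (n - k))))"

definition is_flow :: "'a topology \<Rightarrow> (real \<Rightarrow> 'a \<Rightarrow> 'a) \<Rightarrow> bool" where
  "is_flow X \<Phi> \<longleftrightarrow>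
     continuous_map (prod_topology euclideanreal X) X (\<lambda>(t, x). \<Phi> t x) \<and>
     (\<forall>x\<in>topspace X. \<Phi> 0 x = x) \<and>
     (\<forall>x\<in>topspace X. \<forall>s t. \<Phi> (s + t) x = \<Phi> s (\<Phi> t x))"

definition regular_open :: "'a topology \<Rightarrow> 'a set \<Rightarrow> bool" where
  "regular_open X A \<longleftrightarrow> openin X A \<and> X frontier_of A = X frontier_of (X closure_of A)"

definition forward_invariant :: "(real \<Rightarrow> 'a \<Rightarrow> 'a) \<Rightarrow> 'a set \<Rightarrow> bool" where
  "forward_invariant \<Phi> A \<longleftrightarrow> (\<forall>x\<in>A. {\<Phi> t x | t. t \<ge> 0} \<subseteq> A)"

definition exit_time :: "(real \<Rightarrow> 'a \<Rightarrow> 'a) \<Rightarrow> 'a set \<Rightarrow> 'a \<Rightarrow> real" where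
  "exit_time \<Phi> A x = Inf {t. t > 0 \<and> \<Phi> t x \<notin> A}"

definition first_out_map :: "'a topology \<Rightarrow> (real \<Rightarrow> 'a \<Rightarrow> 'a) \<Rightarrow> 'a set \<Rightarrow> 'a \<rightharpoonup> 'a" where
  "first_out_map X \<Phi> A x =
     (if x \<in> X frontier_of A \<and> {t. t > 0 \<and> \<Phi> t x \<notin> A} \<noteq> {}
      then Some (\<Phi> (exit_time \<Phi> A x) x) else None)"

definition return_time :: "(real \<Rightarrow> 'a \<Rightarrow> 'a) \<Rightarrow> 'a set \<Rightarrow> 'a \<Rightarrow> real" where
  "return_time \<Phi> B x = Inf {t. t > 0 \<and> \<Phi> t x \<in> B}"

definition first_in_map :: "'a topology \<Rightarrow> (real \<Rightarrow> 'a \<Rightarrow> 'a) \<Rightarrow> 'a set \<Rightarrow> 'a \<rightharpoonup> 'a" where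
  "first_in_map X \<Phi> B x =
     (if x \<in> X frontier_of B \<and> {t. t > 0 \<and> \<Phi> t x \<in> B} \<noteq> {}
      then Some (\<Phi> (return_time \<Phi> B x) x) else None)"

definition type_C :: "'a topology \<Rightarrow> (real \<Rightarrow> 'a \<Rightarrow> 'a) \<Rightarrow> 'a set \<Rightarrow> 'a \<Rightarrow> bool" where
  "type_C X \<Phi> A x \<longleftrightarrow>
     x \<in> X frontier_of A \<and>
     x \<in> dom (first_in_map X \<Phi> (X closure_of A)) - dom (first_out_map X \<Phi> A)"

definition forward_transversal_at ::
    "nat \<Rightarrow> 'a topology \<Rightarrow> (real \<Rightarrow> 'a \<Rightarrow> 'a) \<Rightarrow> 'a set \<Rightarrow> 'a \<Rightarrow> bool" where
  "forward_transversal_at n X \<Phi> S x \<longleftrightarrow>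
     locally_flat_submanifold n 1 X S \<and>
     (\<exists>U \<phi>. openin X U \<and> x \<in> U \<and>
        homeomorphic_map (subtopology X U)
          (subtopology (Euclidean_space n) (unit_ball n)) \<phi> \<and>
        \<phi> ` (U \<inter> S) = unit_ball n \<inter> topspace (Euclidean_space (n - 1)) \<and>
        (\<exists>\<delta>>0. \<exists>C\<in>connected_components_of (subtopology X (U - S)).
           (\<lambda>t. \<Phi> t x) ` {0<..\<delta>} \<subseteq> C))"

definition forward_transversal ::
    "nat \<Rightarrow> 'a topology \<Rightarrow> (real \<Rightarrow> 'a \<Rightarrow> 'a) \<Rightarrow> 'a set \<Rightarrow> bool" where
  "forward_transversal n X \<Phi> S \<longleftrightarrow> (\<forall>x\<in>S. forward_transversal_at n X \<Phi> S x)"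

end

theory Submission
  imports Defs "HOL-Homology.Invariance_of_Domain"
begin

text \<open>
  A boundary point is of type C iff its strictly positive orbit lies in \<open>A\<close>.  If this holds on all
  of \<open>\<partial>A\<close>, then no orbit returns to \<open>\<partial>A\<close>, so \<open>(t, y) \<mapsto> \<Phi> t y\<close> is injective on
  \<open>\<real> \<times> \<partial>A\<close> and, by invariance of domain, open.  The part \<open>t > 0\<close> of a flow box lies in \<open>A\<close>; since
  \<open>A\<close> is regular, the part \<open>t < 0\<close> contains a point outside the closure of \<open>A\<close>, and being connected and
  disjoint from \<open>\<partial>A\<close> it misses \<open>A\<close>.  Hence no orbit reaches \<open>\<partial>A\<close> from inside, which is forward
  invariance.  Conversely, transversality keeps short positive orbits off \<open>\<partial>A\<close>, while forward
  invariance of \<open>A\<close> keeps them in the closure of \<open>A\<close>.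
\<close>

section \<open>Euclidean space as an open ball\<close>

lemma continuous_map_Euclidean_space_coordinate:
  "continuous_map (Euclidean_space n) euclideanreal (\<lambda>z. z i)"
  unfolding Euclidean_space_def
  by (intro continuous_map_from_subtopology continuous_map_product_coordinates) auto

text \<open>The radial map z / sqrt (1 + |z|^2) works, with inverse z / sqrt (1 - |z|^2). Both only
  rescale z, so they preserve every standard subspace at once. This links the model of local
  flatness, a whole Euclidean space, with the ball used in transversality.\<close>

lemma Euclidean_space_homeomorphic_unit_ball:
  obtains h where
    "homeomorphic_map (Euclidean_space n) (subtopology (Euclidean_space n) (unit_ball n)) h"
    "\<And>k. k \<le> n \<Longrightarrow> h ` topspace (Euclidean_space k) = unit_ball n \<inter> topspace (Euclidean_space k)"
proof -
  define N where "N z = (\<Sum>i<n. (z i)\<^sup>2)" for z :: "nat \<Rightarrow> real"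
  define h where "h z i = (if i < n then z i / sqrt (1 + N z) else 0)" for z :: "nat \<Rightarrow> real" and i
  define g where "g z i = (if i < n then z i / sqrt (1 - N z) else 0)" for z :: "nat \<Rightarrow> real" and i
  have N0: "N z \<ge> 0" for z
    unfolding N_def by (intro sum_nonneg) auto
  have Nscale: "N (\<lambda>i. if i < n then z i / c else 0) = N z / c\<^sup>2" for z c
    unfolding N_def by (simp add: power_divide sum_divide_distrib)
  have Nh: "N (h z) = N z / (1 + N z)" for z
    using Nscale[of z "sqrt (1 + N z)"] N0[of z] by (simp add: h_def[abs_def])
  have Ng: "N (g z) = N z / (1 - N z)" if "N z < 1" for z
    using Nscale[of z "sqrt (1 - N z)"] that by (simp add: g_def[abs_def])
  have ball: "unit_ball n = {z \<in> topspace (Euclidean_space n). N z < 1}"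
    by (simp add: unit_ball_def N_def)
  have coord: "continuous_map (subtopology (Euclidean_space n) S) euclideanreal (\<lambda>z. z i)" for i S
    by (intro continuous_map_from_subtopology continuous_map_Euclidean_space_coordinate)
  have contN: "continuous_map (subtopology (Euclidean_space n) S) euclideanreal N" for S
    unfolding N_def[abs_def] by (intro continuous_intros coord) auto
  have h_ball: "h z \<in> unit_ball n" for z
  proof -
    have "N (h z) < 1" unfolding Nh using N0[of z] by (simp add: divide_simps)
    then show ?thesis by (simp add: ball topspace_Euclidean_space h_def)
  qed
  have g_h: "g (h z) = z" if "z \<in> topspace (Euclidean_space n)" for z
  proof
    fix i
    \<comment> \<open>This identity makes the two scaling factors reciprocal, so that they cancel in
      \<open>g (h z)\<close>.\<close>
    have "1 - N (h z) = 1 / (1 + N z)" unfolding Nh using N0[of z] by (simp add: divide_simps)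
    then have "sqrt (1 + N z) * sqrt (1 - N (h z)) = 1"
      using N0[of z] by (simp flip: real_sqrt_mult)
    then show "g (h z) i = z i"
      using that by (simp add: g_def h_def topspace_Euclidean_space)
  qed
  have h_g: "h (g z) = z" if "z \<in> unit_ball n" for z
  proof
    fix i
    have z: "z \<in> topspace (Euclidean_space n)" "N z < 1" using that by (auto simp: ball)
    have "1 + N (g z) = 1 / (1 - N z)" unfolding Ng[OF z(2)] using z(2) by (simp add: divide_simps)
    then have "sqrt (1 - N z) * sqrt (1 + N (g z)) = 1"
      using z(2) by (simp flip: real_sqrt_mult)
    then show "h (g z) i = z i"
      using z(1) by (simp add: g_def h_def topspace_Euclidean_space)
  qed
  have sqrt_cont: "continuous_map Y euclideanreal (\<lambda>z. sqrt (f z))"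
    if "continuous_map Y euclideanreal f" for f :: "(nat \<Rightarrow> real) \<Rightarrow> real" and Y
    using continuous_map_compose[OF that, of euclideanreal sqrt]
    by (simp add: o_def continuous_on_real_sqrt)
  have contN': "continuous_map (Euclidean_space n) euclideanreal N"
    using contN[of UNIV] by simp
  have pos: "1 + N z > 0" for z using N0[of z] by simp
  have cont_h: "continuous_map (Euclidean_space n) (Euclidean_space n) h"
    unfolding h_def[abs_def] continuous_map_componentwise_Euclidean_space
  proof (intro allI impI continuous_map_real_divide sqrt_cont continuous_map_add contN'
      continuous_map_Euclidean_space_coordinate)
    show "sqrt (1 + N z) \<noteq> 0" for z using pos[of z] by simp
  qed auto
  have cont_g: "continuous_map (subtopology (Euclidean_space n) (unit_ball n)) (Euclidean_space n) g"
    unfolding g_def[abs_def] continuous_map_componentwise_Euclidean_space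
    by (intro allI impI continuous_map_real_divide sqrt_cont continuous_map_diff contN coord)
       (auto simp: ball)
  have "homeomorphic_maps (Euclidean_space n) (subtopology (Euclidean_space n) (unit_ball n)) h g"
    unfolding homeomorphic_maps_def
    using cont_h cont_g h_ball g_h h_g by (auto simp: continuous_map_in_subtopology)
  then have "homeomorphic_map (Euclidean_space n) (subtopology (Euclidean_space n) (unit_ball n)) h"
    using homeomorphic_map_maps by blast
  moreover have "h ` topspace (Euclidean_space k) = unit_ball n \<inter> topspace (Euclidean_space k)"
    if "k \<le> n" for k
  proof (intro equalityI subsetI)
    fix y assume "y \<in> h ` topspace (Euclidean_space k)"
    then show "y \<in> unit_ball n \<inter> topspace (Euclidean_space k)"
      using h_ball by (auto simp: h_def topspace_Euclidean_space)
  next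
    fix y assume y: "y \<in> unit_ball n \<inter> topspace (Euclidean_space k)"
    then have "g y \<in> topspace (Euclidean_space k)"
      by (auto simp: g_def topspace_Euclidean_space)
    then show "y \<in> h ` topspace (Euclidean_space k)"
      using h_g y by (metis IntD1 image_eqI)
  qed
  ultimately show ?thesis using that by blast
qed

section \<open>Elementary properties of flows\<close>

lemma is_flow_in_topspace:
  assumes "is_flow X \<Phi>" "x \<in> topspace X"
  shows "\<Phi> t x \<in> topspace X"
proof -
  have "continuous_map (prod_topology euclideanreal X) X (\<lambda>(t, x). \<Phi> t x)"
    using assms by (simp add: is_flow_def)
  from continuous_map_funspace[OF this] show ?thesis
    using assms(2) by (auto simp: Pi_iff)
qed

lemma is_flow_0: "is_flow X \<Phi> \<Longrightarrow> x \<in> topspace X \<Longrightarrow> \<Phi> 0 x = x"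
  by (simp add: is_flow_def)

lemma is_flow_add: "is_flow X \<Phi> \<Longrightarrow> x \<in> topspace X \<Longrightarrow> \<Phi> s (\<Phi> t x) = \<Phi> (s + t) x"
  by (simp add: is_flow_def)

lemma is_flow_minus: "is_flow X \<Phi> \<Longrightarrow> x \<in> topspace X \<Longrightarrow> \<Phi> (- t) (\<Phi> t x) = x"
  by (simp add: is_flow_add is_flow_0)

lemma is_flow_continuous_map:
  assumes "is_flow X \<Phi>" "continuous_map Y euclideanreal f" "continuous_map Y X g"
  shows "continuous_map Y X (\<lambda>y. \<Phi> (f y) (g y))"
proof -
  have "continuous_map Y (prod_topology euclideanreal X) (\<lambda>y. (f y, g y))"
    using assms by (simp add: continuous_map_pairwise o_def)
  moreover have "continuous_map (prod_topology euclideanreal X) X (\<lambda>(t, x). \<Phi> t x)"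
    using assms by (simp add: is_flow_def)
  ultimately show ?thesis
    using continuous_map_compose by (fastforce simp: o_def)
qed

lemma is_flow_continuous_map_orbit:
  assumes "is_flow X \<Phi>" "x \<in> topspace X"
  shows "continuous_map euclideanreal X (\<lambda>t. \<Phi> t x)"
  using assms by (intro is_flow_continuous_map[OF assms(1)]) auto

lemma is_flow_openin_orbit:
  assumes "is_flow X \<Phi>" "x \<in> topspace X" "openin X U"
  shows "open {t. \<Phi> t x \<in> U}"
  using openin_continuous_map_preimage[OF is_flow_continuous_map_orbit[OF assms(1,2)] assms(3)]
  by simp

text \<open>The times at which the orbit is in \<open>U\<close> form an open set containing 0. The
  bound is two-sided because positive times serve transversality and negative times serve the
  approach to a first exit point.\<close>

lemma is_flow_stays_in_open:
  assumes "is_flow X \<Phi>" "openin X U" "x \<in> U"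
  obtains \<delta> where "\<delta> > 0" "\<And>t. \<bar>t\<bar> \<le> \<delta> \<Longrightarrow> \<Phi> t x \<in> U"
proof -
  have x: "x \<in> topspace X" using assms openin_subset by blast
  have "open {t. \<Phi> t x \<in> U}" "0 \<in> {t. \<Phi> t x \<in> U}"
    using is_flow_openin_orbit[OF assms(1) x assms(2)] is_flow_0[OF assms(1) x] assms(3) by auto
  then obtain \<delta> where "\<delta> > 0" "cball 0 \<delta> \<subseteq> {t. \<Phi> t x \<in> U}"
    by (meson open_contains_cball)
  then show ?thesis
    by (intro that[of \<delta>]) (auto simp: subset_iff dist_norm)
qed

section \<open>Flow boxes over a hypersurface without returns\<close>

lemma is_flow_injective_if_no_return:
  assumes flow: "is_flow X \<Phi>" and "S \<subseteq> topspace X"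
    and no_return: "\<And>t x. x \<in> S \<Longrightarrow> t > 0 \<Longrightarrow> \<Phi> t x \<notin> S"
    and xy: "x \<in> S" "y \<in> S" and eq: "\<Phi> s x = \<Phi> t y"
  shows "s = t \<and> x = y"
proof -
  have top: "x \<in> topspace X" "y \<in> topspace X" using assms(2) xy by auto
  have "\<Phi> (- s) (\<Phi> t y) = x"
    unfolding eq[symmetric] by (rule is_flow_minus[OF flow top(1)])
  then have x: "\<Phi> (t - s) y = x"
    by (simp add: is_flow_add[OF flow top(2)])
  have "\<Phi> (- t) (\<Phi> s x) = y"
    unfolding eq by (rule is_flow_minus[OF flow top(2)])
  then have y: "\<Phi> (s - t) x = y"
    by (simp add: is_flow_add[OF flow top(1)])
  \<comment> \<open>The flow leads from \<open>y\<close> to \<open>x\<close> in time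
    \<open>t - s\<close> and back in time \<open>s - t\<close>; whichever of these is positive would
    be a return to \<open>S\<close>.\<close>
  have "\<not> t - s > 0"
    using no_return[OF xy(2), of "t - s"] xy(1) unfolding x by blast
  moreover have "\<not> s - t > 0"
    using no_return[OF xy(1), of "s - t"] xy(2) unfolding y by blast
  ultimately have "s = t" by simp
  then show ?thesis using x is_flow_0[OF flow top(2)] by simp
qed

text \<open>Without returns, flowing from the hypersurface is injective in time and starting point
  together. Read in the chart, it is a continuous injection from an open subset of a Euclidean space
  into the same space, hence open by invariance of domain. Connectedness of \<open>V\<close> serves
  to make the part of the box at negative times connected.\<close>

lemma flow_box:
  assumes flow: "is_flow X \<Phi>"
    and U: "openin X U" "homeomorphic_map (subtopology X U) (Euclidean_space (Suc m)) \<phi>"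
    and flat: "\<phi> ` (U \<inter> S) = topspace (Euclidean_space m)"
    and S: "S \<subseteq> topspace X"
    and no_return: "\<And>t x. x \<in> S \<Longrightarrow> t > 0 \<Longrightarrow> \<Phi> t x \<notin> S"
    and p: "p \<in> U" "p \<in> S"
  obtains \<epsilon> V where "\<epsilon> > 0" "connectedin X V" "V \<subseteq> S" "p \<in> V"
    "openin X ((\<lambda>(t, y). \<Phi> t y) ` ({-\<epsilon><..<\<epsilon>} \<times> V))"
proof -
  let ?E = "Euclidean_space m" and ?E' = "Euclidean_space (Suc m)"
  obtain \<psi> where hom: "homeomorphic_maps (subtopology X U) ?E' \<phi> \<psi>"
    using U(2) homeomorphic_map_maps by blast
  have topU: "topspace (subtopology X U) = U"
    by (rule topspace_subtopology_subset[OF openin_subset[OF U(1)]])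
  have cont\<phi>: "continuous_map (subtopology X U) ?E' \<phi>"
    and cont\<psi>U: "continuous_map ?E' (subtopology X U) \<psi>"
    and \<psi>\<phi>: "\<And>x. x \<in> U \<Longrightarrow> \<psi> (\<phi> x) = x"
    and \<phi>\<psi>: "\<And>z. z \<in> topspace ?E' \<Longrightarrow> \<phi> (\<psi> z) = z"
    using hom unfolding homeomorphic_maps_def topU by blast+
  have sub: "topspace ?E \<subseteq> topspace ?E'"
    by simp
  have \<psi>S: "\<psi> z \<in> U \<inter> S" if "z \<in> topspace ?E" for z
  proof -
    obtain x where x: "x \<in> U \<inter> S" "z = \<phi> x" using \<open>z \<in> topspace ?E\<close> unfolding flat[symmetric] by (rule imageE)
    then have "\<psi> z = x" using \<psi>\<phi> by simp
    then show ?thesis using x by simp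
  qed
  have E: "?E = subtopology ?E' (topspace ?E)"
    unfolding Euclidean_space_def subtopology_subtopology topspace_subtopology
    by (rule arg_cong[where f = "subtopology _"]) auto
  have "continuous_map ?E' X \<psi>"
    using cont\<psi>U by (simp add: continuous_map_in_subtopology)
  then have cont\<psi>: "continuous_map ?E X \<psi>"
    using E continuous_map_from_subtopology by metis
  define G where "G = (\<lambda>(t, z). \<Phi> t (\<psi> z))"
  have contG: "continuous_map (prod_topology euclideanreal ?E) X G"
  proof -
    have "continuous_map (prod_topology euclideanreal ?E) X (\<lambda>y. \<Phi> (fst y) (\<psi> (snd y)))"
      by (intro is_flow_continuous_map[OF flow] continuous_map_fst
          continuous_map_compose[OF continuous_map_snd cont\<psi>, unfolded o_def])
    then show ?thesis by (simp add: G_def case_prod_unfold)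
  qed
  define q where "q = \<phi> p"
  have q: "q \<in> topspace ?E" using p flat by (auto simp: q_def)
  have \<psi>q: "\<psi> q = p" using \<psi>\<phi> p q_def by auto
  \<comment> \<open>The box has to stay inside \<open>U\<close> for \<open>\<phi>\<close> to be
    applicable; a product neighborhood of \<open>(0, q)\<close> provides suitable times and starting
    points.\<close>
  have "openin (prod_topology euclideanreal ?E)
      {w \<in> topspace (prod_topology euclideanreal ?E). G w \<in> U}"
    by (rule openin_continuous_map_preimage[OF contG U(1)])
  moreover have "(0, q) \<in> {w \<in> topspace (prod_topology euclideanreal ?E). G w \<in> U}"
    using q \<psi>q p S is_flow_0[OF flow] by (auto simp: G_def)
  ultimately obtain T V0 where "openin euclideanreal T" and T: "0 \<in> T" and V0: "openin ?E V0" "q \<in> V0"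
    and TV0: "T \<times> V0 \<subseteq> {w \<in> topspace (prod_topology euclideanreal ?E). G w \<in> U}"
    unfolding openin_prod_topology_alt by blast
  then have "open T" by simp
  obtain \<epsilon> where \<epsilon>: "\<epsilon> > 0" "{-\<epsilon><..<\<epsilon>} \<subseteq> T"
    using \<open>open T\<close> T by (force simp: open_contains_ball ball_eq_greaterThanLessThan)
  \<comment> \<open>Local connectedness of Euclidean space makes this component open.\<close>
  define V where "V = connected_component_of_set (subtopology ?E V0) q"
  have openV: "openin ?E V"
    using locally_connected_Euclidean_space[of m] V0
    unfolding V_def locally_connected_space_open_connected_components connected_components_of_def
    by (metis (no_types, lifting) image_eqI openin_subset topspace_subtopology_subset)
  have connV: "connectedin ?E V"
    using connectedin_connected_component_of[of "subtopology ?E V0" q]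
    by (simp add: V_def connectedin_subtopology)
  have VV0: "V \<subseteq> V0"
    using connected_component_of_subset_topspace[of "subtopology ?E V0" q] by (auto simp: V_def)
  have Vtop: "V \<subseteq> topspace ?E" using openV openin_subset by blast
  have qV: "q \<in> V"
    using V0 q by (simp add: V_def connected_component_of_refl)
  have GU: "G (t, z) \<in> U" if "t \<in> {-\<epsilon><..<\<epsilon>}" "z \<in> V" for t z
    using that \<epsilon> VV0 TV0 by blast
  \<comment> \<open>\<open>W\<close> is the box of pairs \<open>(t, z)\<close> written inside the
    larger Euclidean space: coordinate \<open>m\<close>, which vanishes on the hyperplane, stores
    the time, and resetting it to 0 recovers \<open>z\<close>.\<close>
  define W where "W = {w \<in> topspace ?E'. w m \<in> {-\<epsilon><..<\<epsilon>} \<and> w(m := 0) \<in> V}"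
  have cont_init: "continuous_map ?E' ?E (\<lambda>w. w(m := 0))"
  proof -
    have "continuous_map ?E' ?E (\<lambda>w i. if i < m then w i else 0)"
      unfolding continuous_map_componentwise_Euclidean_space
      by (intro allI impI continuous_map_Euclidean_space_coordinate)
    then show ?thesis
      by (rule continuous_map_eq) (auto simp: topspace_Euclidean_space fun_eq_iff)
  qed
  have openW: "openin ?E' W"
  proof -
    have "W = {w \<in> topspace ?E'. w m \<in> {-\<epsilon><..<\<epsilon>}} \<inter> {w \<in> topspace ?E'. w(m := 0) \<in> V}"
      by (auto simp: W_def)
    then show ?thesis
      using openin_continuous_map_preimage[OF continuous_map_Euclidean_space_coordinate, of "{-\<epsilon><..<\<epsilon>}"]
        openin_continuous_map_preimage[OF cont_init openV] by auto
  qed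
  define F where "F w = \<phi> (G (w m, w(m := 0)))" for w :: "nat \<Rightarrow> real"
  have GW: "(\<lambda>w. G (w m, w(m := 0))) ` W = G ` ({-\<epsilon><..<\<epsilon>} \<times> V)"
  proof (intro equalityI subsetI)
    fix y assume "y \<in> G ` ({-\<epsilon><..<\<epsilon>} \<times> V)"
    then obtain t z where tz: "y = G (t, z)" "t \<in> {-\<epsilon><..<\<epsilon>}" "z \<in> V" by auto
    have "z m = 0" using tz(3) Vtop by (auto simp: topspace_Euclidean_space)
    then have "z(m := t) \<in> W" "(z(m := t))(m := 0) = z"
      using tz Vtop by (auto simp: W_def topspace_Euclidean_space fun_upd_idem)
    then show "y \<in> (\<lambda>w. G (w m, w(m := 0))) ` W"
      using tz by (intro image_eqI[of _ _ "z(m := t)"]) auto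
  qed (auto simp: W_def)
  have contF: "continuous_map (subtopology ?E' W) ?E' F"
  proof -
    have "continuous_map ?E' (prod_topology euclideanreal ?E) (\<lambda>w. (w m, w(m := 0)))"
      using cont_init by (simp add: continuous_map_pairwise o_def continuous_map_Euclidean_space_coordinate)
    from continuous_map_compose[OF this contG]
    have "continuous_map (subtopology ?E' W) X (\<lambda>w. G (w m, w(m := 0)))"
      by (simp add: o_def continuous_map_from_subtopology)
    then have "continuous_map (subtopology ?E' W) (subtopology X U) (\<lambda>w. G (w m, w(m := 0)))"
      using GU by (auto simp: continuous_map_in_subtopology W_def)
    from continuous_map_compose[OF this cont\<phi>] show ?thesis
      by (simp add: F_def[abs_def] o_def)
  qed
  have injF: "inj_on F W"
  proof (rule inj_onI)
    fix v w assume vw: "v \<in> W" "w \<in> W" "F v = F w"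
    then have "G (v m, v(m := 0)) = G (w m, w(m := 0))"
      using GU \<psi>\<phi> unfolding F_def W_def by (metis (mono_tags, lifting) mem_Collect_eq)
    then have eq: "\<Phi> (v m) (\<psi> (v(m := 0))) = \<Phi> (w m) (\<psi> (w(m := 0)))"
      by (simp add: G_def)
    have V: "v(m := 0) \<in> V" "w(m := 0) \<in> V" using vw by (auto simp: W_def)
    have "v m = w m \<and> \<psi> (v(m := 0)) = \<psi> (w(m := 0))"
      using V Vtop \<psi>S by (intro is_flow_injective_if_no_return[OF flow S no_return _ _ eq]) auto
    then have "v m = w m" "v(m := 0) = w(m := 0)"
      using V Vtop sub \<phi>\<psi> by (blast, metis subsetD)
    then show "v = w"
      by (metis fun_upd_triv fun_upd_upd)
  qed
  have "openin ?E' (F ` W)"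
    by (rule invariance_of_domain_Euclidean_space[OF openW contF injF])
  \<comment> \<open>Applying \<open>\<psi>\<close> undoes the chart in \<open>F\<close>, so this set
    is the flow box itself.\<close>
  then have "openin (subtopology X U) (\<psi> ` F ` W)"
    using hom by (metis homeomorphic_maps_map homeomorphic_imp_open_map open_map_def)
  then have "openin X (\<psi> ` F ` W)"
    using U(1) openin_trans_full by blast
  moreover have "\<psi> ` F ` W = (\<lambda>w. G (w m, w(m := 0))) ` W"
    unfolding image_image F_def using GU \<psi>\<phi> by (intro image_cong) (auto simp: W_def)
  moreover have "G ` ({-\<epsilon><..<\<epsilon>} \<times> V) = (\<lambda>(t, y). \<Phi> t y) ` ({-\<epsilon><..<\<epsilon>} \<times> \<psi> ` V)"
    unfolding G_def by force
  ultimately have "openin X ((\<lambda>(t, y). \<Phi> t y) ` ({-\<epsilon><..<\<epsilon>} \<times> \<psi> ` V))"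
    by (simp add: GW)
  moreover have "connectedin X (\<psi> ` V)"
    using connectedin_continuous_map_image[OF cont\<psi> connV] .
  moreover have "\<psi> ` V \<subseteq> S" using \<psi>S Vtop by auto
  moreover have "p \<in> \<psi> ` V" using qV \<psi>q by auto
  ultimately show ?thesis using that \<epsilon>(1) by blast
qed

text \<open>The negative-time part of a flow box around \<open>p\<close> is connected and misses the
  frontier, so it lies either in \<open>A\<close> or in its complement. Regularity excludes the
  first case.\<close>

lemma backward_orbit_outside:
  assumes flow: "is_flow X \<Phi>" and reg: "regular_open X A"
    and flat: "locally_flat_submanifold n 1 X (X frontier_of A)"
    and forward: "\<And>x t. x \<in> X frontier_of A \<Longrightarrow> t > 0 \<Longrightarrow> \<Phi> t x \<in> A"
    and p: "p \<in> X frontier_of A"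
  obtains \<epsilon> where "\<epsilon> > 0" "\<And>t. -\<epsilon> < t \<Longrightarrow> t < 0 \<Longrightarrow> \<Phi> t p \<notin> A"
proof -
  let ?S = "X frontier_of A"
  have A: "openin X A" and frontier: "?S = X frontier_of (X closure_of A)"
    using reg by (auto simp: regular_open_def)
  have S: "?S \<subseteq> topspace X" by (rule frontier_of_subset_topspace)
  have disj: "?S \<inter> A = {}" using A by (auto simp: frontier_of_openin)
  have no_return: "\<Phi> t x \<notin> ?S" if "x \<in> ?S" "t > 0" for t x
    using forward[OF that] disj by blast
  obtain U \<phi> where "1 \<le> n" and U: "openin X U" "p \<in> U"
    "homeomorphic_map (subtopology X U) (Euclidean_space n) \<phi>"
    "\<phi> ` (U \<inter> ?S) = topspace (Euclidean_space (n - 1))"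
    using flat p unfolding locally_flat_submanifold_def by blast
  then obtain m where m: "n = Suc m" by (cases n) auto
  obtain \<epsilon> V where \<epsilon>: "\<epsilon> > 0" and V: "connectedin X V" "V \<subseteq> ?S" "p \<in> V"
    and box: "openin X ((\<lambda>(t, y). \<Phi> t y) ` ({-\<epsilon><..<\<epsilon>} \<times> V))"
    using flow_box[OF flow U(1) U(3)[unfolded m] _ S no_return U(2) p] U(4) unfolding m by auto
  let ?box = "(\<lambda>(t, y). \<Phi> t y) ` ({-\<epsilon><..<\<epsilon>} \<times> V)"
  let ?past = "(\<lambda>(t, y). \<Phi> t y) ` ({-\<epsilon><..<0} \<times> V)"
  have top: "p \<in> topspace X" using p S by blast
  have "\<Phi> 0 p \<in> ?box" using \<epsilon> V by force
  \<comment> \<open>Regularity enters here: as \<open>p\<close> is also on the frontier of the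
    closure, its open neighborhood \<open>?box\<close> contains a point outside the closure.\<close>
  then have "p \<in> ?box \<inter> X frontier_of (X closure_of A)"
    using is_flow_0[OF flow top] p frontier by simp
  then have "?box - X closure_of A \<noteq> {}"
    by (intro frontier_of_openin_straddle_Int(2)[OF box]) blast
  then obtain t y where ty: "-\<epsilon> < t" "t < \<epsilon>" "y \<in> V" "\<Phi> t y \<notin> X closure_of A"
    by (force simp del: Diff_eq_empty_iff)
  have y: "y \<in> ?S" "y \<in> topspace X" using ty V S by auto
  have "A \<union> ?S \<subseteq> X closure_of A"
    using closure_of_subset[OF openin_subset[OF A]] by (simp add: frontier_of_def)
  then have "\<Phi> t y \<notin> A" "\<Phi> t y \<notin> ?S" using ty(4) by blast+
  \<comment> \<open>Positive times lead into \<open>A\<close> and time 0 gives a frontier point, so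
    the outside point belongs to the past.\<close>
  then have "\<not> t > 0" "t \<noteq> 0"
    using forward[OF y(1)] is_flow_0[OF flow y(2)] y(1) by auto
  then have "?past - A \<noteq> {}"
    using ty \<open>\<Phi> t y \<notin> A\<close> by force
  moreover have "?past \<inter> ?S = {}"
  proof -
    \<comment> \<open>Otherwise this frontier point would return to the frontier, at
      \<open>z\<close>, after the positive time \<open>- s\<close>.\<close>
    have "\<Phi> s z \<notin> ?S" if "s < 0" "z \<in> V" for s z
    proof
      assume *: "\<Phi> s z \<in> ?S"
      have z: "z \<in> ?S" "z \<in> topspace X" using that V S by auto
      have "\<Phi> (- s) (\<Phi> s z) = z" by (rule is_flow_minus[OF flow z(2)])
      then show False using no_return[OF *, of "- s"] that z by simp
    qed
    then show ?thesis by auto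
  qed
  moreover have "connectedin X ?past"
  proof (rule connectedin_continuous_map_image)
    show "continuous_map (prod_topology euclideanreal X) X (\<lambda>(t, y). \<Phi> t y)"
      using flow by (simp add: is_flow_def)
    show "connectedin (prod_topology euclideanreal X) ({-\<epsilon><..<0} \<times> V)"
      using V by (simp add: connectedin_Times)
  qed
  ultimately have "?past \<inter> A = {}"
    using connectedin_Int_frontier_of by blast
  moreover have "\<Phi> t p \<in> ?past" if "-\<epsilon> < t" "t < 0" for t
    using V(3) that by force
  ultimately show ?thesis
    using that[OF \<epsilon>] by blast
qed

section \<open>Type C points and forward invariance\<close>

lemma type_C_iff:
  assumes "is_flow X \<Phi>" "regular_open X A"
  shows "type_C X \<Phi> A x \<longleftrightarrow> x \<in> X frontier_of A \<and> (\<forall>t>0. \<Phi> t x \<in> A)"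
proof -
  have "A \<subseteq> X closure_of A" "X frontier_of A = X frontier_of (X closure_of A)"
    using assms by (auto simp: regular_open_def closure_of_subset openin_subset)
  \<comment> \<open>Having no exit time puts every positive time in \<open>A\<close>; time 1 then
    witnesses the domain of the first-in map.\<close>
  moreover have "\<exists>t>0. \<Phi> t x \<in> X closure_of A" if "\<forall>t>0. \<Phi> t x \<in> A"
    using that \<open>A \<subseteq> X closure_of A\<close> zero_less_one by blast
  ultimately show ?thesis
    by (auto simp: type_C_def first_in_map_def first_out_map_def dom_def)
qed

text \<open>The time-\<open>t\<close> map is continuous, so it sends the closure of \<open>A\<close>
  into the closure of the image of \<open>A\<close>.\<close>

lemma forward_invariant_closure_of:
  assumes flow: "is_flow X \<Phi>" and inv: "forward_invariant \<Phi> A"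
    and x: "x \<in> X closure_of A" and t: "t \<ge> 0"
  shows "\<Phi> t x \<in> X closure_of A"
proof -
  have "continuous_map X X (\<Phi> t)"
    using is_flow_continuous_map[OF flow, of X "\<lambda>_. t" "\<lambda>x. x"] by simp
  then have "\<Phi> t ` (X closure_of A) \<subseteq> X closure_of (\<Phi> t ` A)"
    by (simp add: continuous_map_image_closure_subset)
  also have "\<dots> \<subseteq> X closure_of A"
    using inv t by (intro closure_of_mono) (auto simp: forward_invariant_def)
  finally show ?thesis using x by blast
qed

text \<open>At a small positive time the orbit is off the frontier by transversality and in the
  closure by invariance, hence in \<open>A\<close>. Invariance carries this on to all later
  times.\<close>

lemma forward_transversal_imp_enters:
  assumes flow: "is_flow X \<Phi>" and A: "openin X A" and inv: "forward_invariant \<Phi> A"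
    and trans: "forward_transversal_at n X \<Phi> (X frontier_of A) x"
    and x: "x \<in> X frontier_of A" and t: "t > 0"
  shows "\<Phi> t x \<in> A"
proof -
  have top: "x \<in> topspace X" using x by (meson frontier_of_subset_topspace subsetD)
  obtain U \<delta> C where "\<delta> > 0" "C \<in> connected_components_of (subtopology X (U - X frontier_of A))"
    and C: "(\<lambda>t. \<Phi> t x) ` {0<..\<delta>} \<subseteq> C"
    using trans unfolding forward_transversal_at_def by blast
  then have "C \<subseteq> U - X frontier_of A"
    using connected_components_of_subset by fastforce
  define s where "s = min \<delta> t"
  have s: "0 < s" "s \<le> \<delta>" "s \<le> t" using \<open>\<delta> > 0\<close> t by (auto simp: s_def)
  have "\<Phi> s x \<notin> X frontier_of A"
    using s C \<open>C \<subseteq> U - X frontier_of A\<close> by fastforce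
  moreover have "\<Phi> s x \<in> X closure_of A"
    using forward_invariant_closure_of[OF flow inv, of x s] x s by (simp add: frontier_of_def)
  ultimately have "\<Phi> s x \<in> A"
    using A by (simp add: frontier_of_openin)
  then have "\<Phi> (t - s) (\<Phi> s x) \<in> A"
    using inv s unfolding forward_invariant_def by fastforce
  then show ?thesis
    by (simp add: is_flow_add[OF flow top])
qed

text \<open>An orbit leaving \<open>A\<close> has a first exit point. It lies on the frontier and is
  approached from inside \<open>A\<close>, which \<open>backward_orbit_outside\<close>
  forbids.\<close>

lemma forward_invariant_if_frontier_enters:
  assumes flow: "is_flow X \<Phi>" and reg: "regular_open X A"
    and flat: "locally_flat_submanifold n 1 X (X frontier_of A)"
    and forward: "\<And>x t. x \<in> X frontier_of A \<Longrightarrow> t > 0 \<Longrightarrow> \<Phi> t x \<in> A"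
  shows "forward_invariant \<Phi> A"
proof -
  have A: "openin X A" using reg by (simp add: regular_open_def)
  have "\<Phi> t x \<in> A" if x: "x \<in> A" and t: "t \<ge> 0" for x t
  proof (rule ccontr)
    assume exit: "\<Phi> t x \<notin> A"
    have top: "x \<in> topspace X" using x A openin_subset by blast
    \<comment> \<open>Compactness of \<open>T\<close> makes the first exit time attained.\<close>
    define T where "T = {0..t} \<inter> {s. \<Phi> s x \<notin> A}"
    have "closed {s. \<Phi> s x \<notin> A}"
      using is_flow_openin_orbit[OF flow top A] by (simp add: closed_def Collect_neg_eq)
    then have "compact T" "T \<noteq> {}"
      using exit t by (auto simp: T_def intro!: compact_Int_closed)
    then obtain s where "s \<in> T" and min: "\<And>r. r \<in> T \<Longrightarrow> s \<le> r"
      using compact_attains_inf by metis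
    then have s: "0 \<le> s" "s \<le> t" "\<Phi> s x \<notin> A" by (auto simp: T_def)
    have before: "\<Phi> r x \<in> A" if "0 \<le> r" "r < s" for r
      using min[of r] that s by (fastforce simp: T_def)
    have "s > 0" using s x is_flow_0[OF flow top] by (cases "s = 0") auto
    have "\<Phi> s x \<in> X closure_of A"
      unfolding in_closure_of
    proof (intro conjI allI impI)
      show "\<Phi> s x \<in> topspace X" by (rule is_flow_in_topspace[OF flow top])
      fix B assume B: "\<Phi> s x \<in> B \<and> openin X B"
      then obtain \<delta> where "\<delta> > 0" and \<delta>: "\<And>t. \<bar>t\<bar> \<le> \<delta> \<Longrightarrow> \<Phi> t (\<Phi> s x) \<in> B"
        using is_flow_stays_in_open[OF flow] by metis
      define r where "r = min \<delta> s"
      have "\<Phi> (s - r) x \<in> B"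
        using \<delta>[of "- r"] \<open>\<delta> > 0\<close> \<open>s > 0\<close> by (simp add: is_flow_add[OF flow top] r_def)
      moreover have "\<Phi> (s - r) x \<in> A"
        using \<open>\<delta> > 0\<close> \<open>s > 0\<close> by (intro before) (auto simp: r_def)
      ultimately show "\<exists>y. y \<in> A \<and> y \<in> B" by blast
    qed
    then have "\<Phi> s x \<in> X frontier_of A"
      using s A by (simp add: frontier_of_openin)
    then obtain \<epsilon> where "\<epsilon> > 0" and \<epsilon>: "\<And>r. -\<epsilon> < r \<Longrightarrow> r < 0 \<Longrightarrow> \<Phi> r (\<Phi> s x) \<notin> A"
      using backward_orbit_outside[OF flow reg flat forward] by metis
    \<comment> \<open>Halving meets the strict bound \<open>-\<epsilon> < - r\<close>; the cap
      \<open>s\<close> keeps the time \<open>s - r\<close> nonnegative, where the orbit is still in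
      \<open>A\<close>.\<close>
    define r where "r = min (\<epsilon> / 2) s"
    have "\<Phi> (s - r) x \<notin> A"
      using \<epsilon>[of "- r"] \<open>\<epsilon> > 0\<close> \<open>s > 0\<close> by (simp add: is_flow_add[OF flow top] r_def)
    moreover have "\<Phi> (s - r) x \<in> A"
      using \<open>\<epsilon> > 0\<close> \<open>s > 0\<close> by (intro before) (auto simp: r_def)
    ultimately show False by blast
  qed
  then show ?thesis by (auto simp: forward_invariant_def)
qed

section \<open>Ball charts and transversality\<close>

lemma locally_flat_submanifold_unit_ball_chart:
  assumes "locally_flat_submanifold n 1 X S" "x \<in> S"
  obtains U \<phi> where "openin X U" "x \<in> U"
    "homeomorphic_map (subtopology X U) (subtopology (Euclidean_space n) (unit_ball n)) \<phi>"
    "\<phi> ` (U \<inter> S) = unit_ball n \<inter> topspace (Euclidean_space (n - 1))"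
proof -
  obtain U \<phi> where U: "openin X U" "x \<in> U"
    "homeomorphic_map (subtopology X U) (Euclidean_space n) \<phi>"
    "\<phi> ` (U \<inter> S) = topspace (Euclidean_space (n - 1))"
    using assms unfolding locally_flat_submanifold_def by blast
  obtain h where h:
    "homeomorphic_map (Euclidean_space n) (subtopology (Euclidean_space n) (unit_ball n)) h"
    "\<And>k. k \<le> n \<Longrightarrow> h ` topspace (Euclidean_space k) = unit_ball n \<inter> topspace (Euclidean_space k)"
    using Euclidean_space_homeomorphic_unit_ball by metis
  show ?thesis
  proof (rule that[OF U(1,2)])
    show "homeomorphic_map (subtopology X U) (subtopology (Euclidean_space n) (unit_ball n)) (h \<circ> \<phi>)"
      using U(3) h(1) by (rule homeomorphic_map_compose)
    show "(h \<circ> \<phi>) ` (U \<inter> S) = unit_ball n \<inter> topspace (Euclidean_space (n - 1))"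
      using h(2)[of "n - 1"] by (simp only: image_comp[symmetric] U(4) diff_le_self)
  qed
qed

text \<open>Local flatness supplies the ball chart. A short positive orbit stays in its domain
  \<open>U\<close> and, lying in \<open>A\<close>, avoids the frontier; as a continuous image of an
  interval it is connected and so fits in one component.\<close>

lemma forward_transversal_if_frontier_enters:
  assumes flow: "is_flow X \<Phi>" and A: "openin X A"
    and flat: "locally_flat_submanifold n 1 X (X frontier_of A)"
    and forward: "\<And>x t. x \<in> X frontier_of A \<Longrightarrow> t > 0 \<Longrightarrow> \<Phi> t x \<in> A"
  shows "forward_transversal n X \<Phi> (X frontier_of A)"
  unfolding forward_transversal_def
proof
  fix x assume x: "x \<in> X frontier_of A"
  then have top: "x \<in> topspace X" by (meson frontier_of_subset_topspace subsetD)
  obtain U \<phi> where U: "openin X U" "x \<in> U" and chart: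
    "homeomorphic_map (subtopology X U) (subtopology (Euclidean_space n) (unit_ball n)) \<phi>"
    "\<phi> ` (U \<inter> X frontier_of A) = unit_ball n \<inter> topspace (Euclidean_space (n - 1))"
    using locally_flat_submanifold_unit_ball_chart[OF flat x] by metis
  obtain \<delta> where "\<delta> > 0" and \<delta>: "\<And>t. \<bar>t\<bar> \<le> \<delta> \<Longrightarrow> \<Phi> t x \<in> U"
    using is_flow_stays_in_open[OF flow U] by metis
  let ?Y = "subtopology X (U - X frontier_of A)" and ?orbit = "(\<lambda>t. \<Phi> t x) ` {0<..\<delta>}"
  have "connectedin X ?orbit"
    by (rule connectedin_continuous_map_image[OF is_flow_continuous_map_orbit[OF flow top]]) simp
  moreover have "?orbit \<subseteq> U - X frontier_of A"
    using \<delta> forward[OF x] A by (fastforce simp: frontier_of_openin)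
  ultimately have "connectedin ?Y ?orbit"
    by (simp add: connectedin_subtopology)
  moreover have "?Y \<noteq> trivial_topology"
    using calculation \<open>\<delta> > 0\<close> connectedin_subset_topspace by fastforce
  ultimately have "\<exists>C\<in>connected_components_of ?Y. ?orbit \<subseteq> C"
    by (metis exists_connected_component_of_superset)
  then show "forward_transversal_at n X \<Phi> (X frontier_of A) x"
    unfolding forward_transversal_at_def using flat U chart \<open>\<delta> > 0\<close> by blast
qed

theorem theorem3p26:
  fixes X :: "'a topology" and n :: nat and \<Phi> :: "real \<Rightarrow> 'a \<Rightarrow> 'a" and A :: "'a set"
  assumes "topological_manifold n X"
    and "is_flow X \<Phi>"
    and "regular_open X A"
    and "locally_flat_submanifold n 1 X (X frontier_of A)"
  shows "(forward_invariant \<Phi> A \<and> forward_transversal n X \<Phi> (X frontier_of A))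
    \<longleftrightarrow> (\<forall>x\<in>X frontier_of A. type_C X \<Phi> A x)"
proof -
  have A: "openin X A" using assms(3) by (simp add: regular_open_def)
  \<comment> \<open>Both implications pass through this condition on strictly positive
    orbits.\<close>
  have "(\<forall>x\<in>X frontier_of A. type_C X \<Phi> A x) \<longleftrightarrow>
      (\<forall>x\<in>X frontier_of A. \<forall>t>0. \<Phi> t x \<in> A)"
    using type_C_iff[OF assms(2,3)] by blast
  moreover have "\<Phi> t x \<in> A"
    if "forward_invariant \<Phi> A" "forward_transversal n X \<Phi> (X frontier_of A)"
      "x \<in> X frontier_of A" "t > 0" for x t
    using forward_transversal_imp_enters[OF assms(2) A that(1) _ that(3,4)] that(2,3)
    unfolding forward_transversal_def by blast
  ultimately show ?thesis
    using forward_invariant_if_frontier_enters[OF assms(2-4)]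
      forward_transversal_if_frontier_enters[OF assms(2) A assms(4)] by blast
qed

end
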